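(* Let $A\in\mathbb{R}^{m\times p}$, $B\in\mathbb{R}^{q\times n}$ and $C\in\mathbb{R}^{m\times n}$ be such that the matrix equation $AXB=C$ is consistent. Assume that $0<\alpha<\frac{2}{\|B\|_2^2}$. Let $\{X^k\}_{k=0}^\infty$ be the sequence generated by the ME-GRBK method (described in the context) from an initial matrix $X^0\in\mathbb{R}^{p\times q}$ with $\mathrm{vec}(X^0)\in R(B\otimes A^T)$. Then $\{X^k\}$ converges in expectation to the unique least-norm solution $X_*=A^+CB^+$ of $AXB=C$. Moreover, $$E\left[\|X^1-X_*\|_F^2\right]\le\left(1-\frac{(2\alpha-\alpha^2\|B\|_2^2)\|B\|_F^2}{\kappa_{F,2}^2(B^T\otimes A)}\right)\|X^0-X_*\|_F^2,$$ and, for $k=1,2,\ldots$, $$E_k\left[\|X^{k+1}-X_*\|_F^2\right]\le\left(1-\frac{(2\alpha-\alpha^2\|B\|_2^2)\varphi_k}{\kappa_{F,2}^2(B^T\otimes A)}\right)\|X^k-X_*\|_F^2,$$ where $\varphi_k=\frac{\|B^T\otimes A\|_F^2}{2\gamma_k}+\frac{\|B\|_F^2}{2}$, $\gamma_k=\|A\|_F^2-\sum_{i\in\Omega_k}\|A_{i,:}\|_2^2$ and $\Omega_k=\{i\in[m] : \|R^k_{i,:}\|_2^2=0\}$. As a result, $$E\left[\|X^{k+1}-X_*\|_F^2\right]\le\prod_{l=0}^{k}\rho_l\,\|X^0-X_*\|_F^2,$$ where $\rho_0=1-\frac{(2\alpha-\alpha^2\|B\|_2^2)\|B\|_F^2}{\kappa_{F,2}^2(B^T\otimes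 A)}$ and $\rho_l=1-\frac{(2\alpha-\alpha^2\|B\|_2^2)\varphi_l}{\kappa_{F,2}^2(B^T\otimes A)}$ for $l=1,2,\ldots,k$.
   Context: Notation: for a real matrix $M$, $M^T$ is the transpose, $M^+$ the Moore–Penrose inverse, $R(M)$ the range (column space), $\|M\|_2$ the spectral norm (Euclidean norm for vectors), $\|M\|_F$ the Frobenius norm, $M_{i,:}$ the $i$-th row; $\otimes$ is the Kronecker product; $\mathrm{vec}(\cdot)$ stacks the columns of a matrix; $[m]=\{1,\ldots,m\}$; $\kappa_{F,2}(M):=\|M\|_F\|M^+\|_2$. The least-norm solution is the solution of $AXB=C$ of minimal Frobenius norm. All rows of $A$ are nonzero and $B\ne0$. ME-GRBK method: given $X^0$, put $R^0=C-AX^0B$. For $k=0,1,2,\ldots$ until convergence: (1) $\zeta_k=\frac12\left[\frac{1}{\|R^k\|_F^2}\max_{1\le i\le m}\left(\frac{\|R^k_{i,:}\|_2^2}{\|A_{i,:}\|_2^2}\right)+\frac{1}{\|A\|_F^2}\right]$; (2) $\mathcal{J}_k=\{i\in[m] : \|R^k_{i,:}\|_2^2\ge\zeta_k\|A_{i,:}\|_2^2\|R^k\|_F^2\}$; (3) $\widetilde R^k$ is the matrix with rows $\widetilde R^k_{i,:}=R^k_{i,:}$ if $i\in\mathcal{J}_k$ and $\widetilde R^k_{i,:}=0$ otherwise; (4) choose $i_k\in\mathcal{J}_k$ at random, the index $i$ being chosen (conditionally on the past) with probability $\|\widetilde R^k_{i,:}\|_2^2/\|\widetilde R^k\|_F^2$;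 (5) $X^{k+1}=X^k+\frac{\alpha}{\|A_{i_k,:}\|_2^2}A_{i_k,:}^TR^k_{i_k,:}B^T$; (6) $R^{k+1}=R^k-\frac{\alpha}{\|A_{i_k,:}\|_2^2}(AA^T)_{:,i_k}R^k_{i_k,:}B^TB$ (so that $R^k=C-AX^kB$ for all $k$), where $(AA^T)_{:,i_k}$ is the $i_k$-th column of $AA^T$. $E_k[\cdot]=E[\cdot\mid i_0,i_1,\ldots,i_{k-1}]$ is the expectation conditional on the first $k$ iterations, where $i_s$ is the row index selected at iteration $s$. Convergence in expectation to $X_*$ means $E[\|X^k-X_*\|_F^2]\to0$. The iteration stops once $R^k=0$ (the sequence is then taken constant from that point on); the quantities $\zeta_k,\gamma_k,\varphi_k$ and the bounds involving them are understood for iterations with $R^k\ne0$.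
   Formalization: In the last bound the factors ρ_l (l≥1) are random and the displayed inequality can fail along a trajectory, so the right-hand side is replaced by the expectation of the product of the ρ_l times ‖X^0−X_*‖_F^2, with ρ_l taken as 0 once R^l=0 for l≥1. *)

theory Defs
  imports "HOL-Probability.Probability"
begin

text \<open>
  A real $m \times n$ matrix has type \<^typ>\<open>real^'n^'m\<close>, and \<^term>\<open>M $ i\<close> is its \<open>i\<close>-th row.
  The norm of this type is the Frobenius norm (on a single row: the Euclidean norm).
\<close>

lemma norm_matrix_Frobenius:
  fixes M :: "real^'n^'m"
  shows "norm M = sqrt (\<Sum>i\<in>UNIV. \<Sum>j\<in>UNIV. (M $ i $ j)\<^sup>2)"
  by (simp add: norm_vec_def L2_set_def sum_nonneg)

definition spectral_norm :: "real^'n^'m \<Rightarrow> real" where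
  "spectral_norm M = onorm (\<lambda>x. M *v x)"

definition is_pinv :: "real^'n^'m \<Rightarrow> real^'m^'n \<Rightarrow> bool" where
  "is_pinv M P \<longleftrightarrow>
     M ** P ** M = M \<and> P ** M ** P = P \<and>
     transpose (M ** P) = M ** P \<and> transpose (P ** M) = P ** M"

text \<open>The Moore--Penrose inverse; the four Penrose equations have exactly one solution.\<close>

definition pinv :: "real^'n^'m \<Rightarrow> real^'m^'n" where
  "pinv M = (THE P. is_pinv M P)"

definition cond_F2 :: "real^'n^'m \<Rightarrow> real" where
  "cond_F2 M = norm M * spectral_norm (pinv M)"

text \<open>
  Rows and columns of a Kronecker product are indexed by pairs: the first component is the
  block index, the second the index inside the block. Accordingly \<open>vec X\<close> is indexed by
  (column of \<open>X\<close>, row of \<open>X\<close>), which is the stacking of the columns of \<open>X\<close>.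
\<close>

definition kron :: "real^'b^'a \<Rightarrow> real^'d^'c \<Rightarrow> real^('b \<times> 'd)^('a \<times> 'c)" where
  "kron M N = (\<chi> r c. M $ fst r $ fst c * N $ snd r $ snd c)"

definition vec_cols :: "real^'n^'m \<Rightarrow> real^('n \<times> 'm)" where
  "vec_cols X = (\<chi> r. X $ snd r $ fst r)"

lemma vec_cols_sandwich:
  fixes A :: "real^'p^'m" and X :: "real^'q^'p" and B :: "real^'n^'q"
  shows "vec_cols (A ** X ** B) = kron (transpose B) A *v vec_cols X"
  unfolding vec_eq_iff
proof
  fix r :: "'n \<times> 'm"
  have "vec_cols (A ** X ** B) $ r
      = (\<Sum>j\<in>UNIV. \<Sum>i\<in>UNIV. B $ j $ fst r * A $ snd r $ i * X $ i $ j)"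
    by (simp add: vec_cols_def matrix_matrix_mult_def sum_distrib_left mult_ac)
  also have "\<dots> = (\<Sum>c\<in>UNIV. B $ fst c $ fst r * A $ snd r $ snd c * X $ snd c $ fst c)"
    by (simp add: sum.cartesian_product case_prod_beta)
  also have "\<dots> = (kron (transpose B) A *v vec_cols X) $ r"
    by (simp add: kron_def vec_cols_def matrix_vector_mult_def transpose_def)
  finally show "vec_cols (A ** X ** B) $ r = (kron (transpose B) A *v vec_cols X) $ r" .
qed

definition least_norm_solution ::
  "real^'p^'m \<Rightarrow> real^'n^'q \<Rightarrow> real^'n^'m \<Rightarrow> real^'q^'p \<Rightarrow> bool" where
  "least_norm_solution A B C X \<longleftrightarrow>
     A ** X ** B = C \<and> (\<forall>Y. A ** Y ** B = C \<longrightarrow> norm X \<le> norm Y)"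

text \<open>In the following definitions \<open>R\<close> is the current residual.\<close>

definition grbk_zeta :: "real^'p^'m \<Rightarrow> real^'n^'m \<Rightarrow> real" where
  "grbk_zeta A R =
     1/2 * (1 / (norm R)\<^sup>2 * (MAX i. (norm (R $ i))\<^sup>2 / (norm (A $ i))\<^sup>2) + 1 / (norm A)\<^sup>2)"

definition grbk_J :: "real^'p^'m \<Rightarrow> real^'n^'m \<Rightarrow> 'm set" where
  "grbk_J A R = {i. (norm (R $ i))\<^sup>2 \<ge> grbk_zeta A R * (norm (A $ i))\<^sup>2 * (norm R)\<^sup>2}"

definition grbk_Rtilde :: "real^'p^'m \<Rightarrow> real^'n^'m \<Rightarrow> real^'n^'m" where
  "grbk_Rtilde A R = (\<chi> i. if i \<in> grbk_J A R then R $ i else 0)"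

definition grbk_prob :: "real^'p^'m \<Rightarrow> real^'n^'m \<Rightarrow> 'm \<Rightarrow> real" where
  "grbk_prob A R i = (norm (grbk_Rtilde A R $ i))\<^sup>2 / (norm (grbk_Rtilde A R))\<^sup>2"

definition grbk_Omega :: "real^'n^'m \<Rightarrow> 'm set" where
  "grbk_Omega R = {i. (norm (R $ i))\<^sup>2 = 0}"

definition grbk_gamma :: "real^'p^'m \<Rightarrow> real^'n^'m \<Rightarrow> real" where
  "grbk_gamma A R = (norm A)\<^sup>2 - (\<Sum>i\<in>grbk_Omega R. (norm (A $ i))\<^sup>2)"

definition grbk_phi :: "real^'p^'m \<Rightarrow> real^'n^'q \<Rightarrow> real^'n^'m \<Rightarrow> real" where
  "grbk_phi A B R =
     (norm (kron (transpose B) A))\<^sup>2 / (2 * grbk_gamma A R) + (norm B)\<^sup>2 / 2"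

definition grbk_rho0 :: "real^'p^'m \<Rightarrow> real^'n^'q \<Rightarrow> real \<Rightarrow> real" where
  "grbk_rho0 A B \<alpha> =
     1 - (2 * \<alpha> - \<alpha>\<^sup>2 * (spectral_norm B)\<^sup>2) * (norm B)\<^sup>2 / (cond_F2 (kron (transpose B) A))\<^sup>2"

definition grbk_rho :: "real^'p^'m \<Rightarrow> real^'n^'q \<Rightarrow> real \<Rightarrow> real^'n^'m \<Rightarrow> real" where
  "grbk_rho A B \<alpha> R =
     1 - (2 * \<alpha> - \<alpha>\<^sup>2 * (spectral_norm B)\<^sup>2) * grbk_phi A B R / (cond_F2 (kron (transpose B) A))\<^sup>2"

text \<open>
  The factor of iteration \<open>l\<close> along a trajectory \<open>R 0, R 1, \<dots>\<close> of residuals. If the iteration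
  has stopped (\<open>R l = 0\<close> with \<open>l \<ge> 1\<close>), then \<open>\<gamma> = 0\<close> and the formula for \<open>\<phi>\<close> is meaningless;
  the error is already zero and the factor is taken to be \<open>0\<close>.
\<close>

definition grbk_factor ::
  "real^'p^'m \<Rightarrow> real^'n^'q \<Rightarrow> real \<Rightarrow> (nat \<Rightarrow> real^'n^'m) \<Rightarrow> nat \<Rightarrow> real" where
  "grbk_factor A B \<alpha> R l =
     (if l = 0 then grbk_rho0 A B \<alpha> else if R l = 0 then 0 else grbk_rho A B \<alpha> (R l))"

text \<open>The sigma-algebra generated by the row indices \<open>I 0, \<dots>, I (k - 1)\<close>.\<close>

definition past :: "'w measure \<Rightarrow> (nat \<Rightarrow> 'w \<Rightarrow> 'm) \<Rightarrow> nat \<Rightarrow> 'w measure" where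
  "past M I k = vimage_algebra (space M) (\<lambda>\<omega>. map (\<lambda>s. I s \<omega>) [0..<k]) (count_space UNIV)"

text \<open>
  \<open>I k\<close>, \<open>X k\<close>, \<open>R k\<close> are the index selected at iteration \<open>k\<close>, the iterate and the residual, as
  random variables on \<open>M\<close>. Once \<open>R k = 0\<close>, the updates leave \<open>X\<close> and \<open>R\<close> unchanged whatever
  index \<open>I k\<close> is, so the stopped sequence is constant and no law for \<open>I k\<close> is required there.
\<close>

definition me_grbk ::
  "'w measure \<Rightarrow> real^'p^'m \<Rightarrow> real^'n^'q \<Rightarrow> real^'n^'m \<Rightarrow> real \<Rightarrow> real^'q^'p \<Rightarrow>
   (nat \<Rightarrow> 'w \<Rightarrow> 'm) \<Rightarrow> (nat \<Rightarrow> 'w \<Rightarrow> real^'q^'p) \<Rightarrow> (nat \<Rightarrow> 'w \<Rightarrow> real^'n^'m) \<Rightarrow> bool" where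
  "me_grbk M A B C \<alpha> X0 I X R \<longleftrightarrow>
     prob_space M \<and>
     (\<forall>k. I k \<in> measurable M (count_space UNIV)) \<and>
     (\<forall>\<omega>\<in>space M. X 0 \<omega> = X0 \<and> R 0 \<omega> = C - A ** X0 ** B) \<and>
     (\<forall>k. \<forall>\<omega>\<in>space M. let i = I k \<omega> in
        X (Suc k) \<omega> = X k \<omega> + (\<alpha> / (norm (A $ i))\<^sup>2) *\<^sub>R
          ((columnvector (A $ i) :: real^1^'p) ** rowvector (R k \<omega> $ i) ** transpose B) \<and>
        R (Suc k) \<omega> = R k \<omega> - (\<alpha> / (norm (A $ i))\<^sup>2) *\<^sub>R
          ((columnvector (column i (A ** transpose A)) :: real^1^'m) ** rowvector (R k \<omega> $ i)
             ** (transpose B ** B))) \<and>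
     (\<forall>k i. AE \<omega> in M. R k \<omega> \<noteq> 0 \<longrightarrow>
        real_cond_exp M (past M I k) (indicator {\<omega>\<in>space M. I k \<omega> = i}) \<omega>
          = grbk_prob A (R k \<omega>) i)"

end

theory Submission
  imports Defs
begin

text \<open>
  Every row \<open>i\<close> in \<open>J\<^sub>k\<close> has a ratio of squared norms (row of \<open>R\<^sup>k\<close> over row of \<open>A\<close>) of at least
  \<open>\<zeta>\<^sub>k\<parallel>R\<^sup>k\<parallel>\<^sup>2\<close>, so the contraction by the factor \<open>\<rho>\<^sub>k\<close> holds for each admissible row and not only on
  average over the random choice. The index lies in \<open>J\<^sub>k\<close> almost surely; hence the error bound by
  the product of the \<open>\<rho>\<^sub>l\<close> holds almost surely along trajectories, and all expectation
  bounds follow by integration. This matters for the last bound: the \<open>\<rho>\<^sub>l\<close> are random and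
  correlated with the error, so the conditional bounds alone would not yield it.

  The errors stay in the set of matrices \<open>A\<^sup>T Z B\<^sup>T\<close>, on which the residual controls the error
  through the spectral norm of the Moore--Penrose inverse of the Kronecker product.
\<close>

subsection \<open>The Moore--Penrose inverse\<close>

text \<open>Split \<open>y\<close> orthogonally as \<open>A *v x + z\<close> with \<open>z\<close>
  orthogonal to the range of \<open>A\<close>. Then \<open>transpose A\<close> kills
  \<open>z\<close>, so \<open>x\<close> solves the normal equation for \<open>y\<close>.\<close>

lemma normal_equation_solvable:
  fixes A :: "real^'n^'m"
  shows "\<exists>G. transpose A ** A ** G = transpose A"
proof -
  have "\<exists>x. transpose A *v (A *v x) = transpose A *v y" for y
  proof -
    obtain u z where u: "u \<in> span (range ((*v) A))"
      and z: "\<And>w. w \<in> span (range ((*v) A)) \<Longrightarrow> orthogonal z w" and y: "y = u + z"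
      using orthogonal_subspace_decomp_exists[of "range ((*v) A)" y] by blast
    have "span (range ((*v) A)) = range ((*v) A)"
      by (simp add: span_eq_iff linear_subspace_image)
    with u obtain x where x: "u = A *v x" by auto
    have "inner (transpose A *v z) w = 0" for w
      using z[OF span_base, of "A *v w"] dot_lmul_matrix[of z A w]
      by (simp add: orthogonal_def del: vector_transpose_matrix)
    then have "transpose A *v z = 0" using inner_eq_zero_iff by blast
    then show ?thesis
      unfolding y x by (intro exI[of _ x]) (simp only: matrix_vector_right_distrib, simp)
  qed
  then obtain x where x: "\<And>y. transpose A *v (A *v x y) = transpose A *v y" by metis
  \<comment> \<open>Column \<open>j\<close> of \<open>G\<close> is the solution found for the
    \<open>j\<close>-th unit vector.\<close>
  define G :: "real^'m^'n" where "G = (\<chi> i j. x (axis j 1) $ i)"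
  have "(transpose A ** A ** G) $ i $ j = (transpose A *v axis j 1) $ i" for i j
    unfolding x[symmetric] matrix_vector_mul_assoc
    by (simp add: matrix_matrix_mult_def[of "transpose A ** A"] matrix_vector_mult_def G_def)
  then have "transpose A ** A ** G = transpose A"
    by (simp only: vec_eq_iff matrix_vector_mult_basis) (simp add: column_def)
  then show ?thesis by blast
qed

text \<open>Multiplying the normal equation by \<open>transpose G\<close> gives
  \<open>transpose S ** S = transpose S\<close> for \<open>S = A ** G\<close>. The left side is
  symmetric, hence so is \<open>S\<close>. The transposed normal equation then reads
  \<open>S ** A = A\<close>.\<close>

lemma least_squares_inverse:
  fixes A :: "real^'n^'m"
  shows "\<exists>G. A ** G ** A = A \<and> transpose (A ** G) = A ** G"
proof -
  obtain G where G: "transpose A ** A ** G = transpose A" using normal_equation_solvable by blast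
  have "transpose (A ** G) ** (A ** G) = transpose (A ** G)"
    by (metis G matrix_mul_assoc matrix_transpose_mul)
  then have sym: "transpose (A ** G) = A ** G"
    by (metis matrix_transpose_mul transpose_transpose)
  have "transpose (A ** G) ** A = A"
    by (metis G matrix_mul_assoc matrix_transpose_mul transpose_transpose)
  with sym show ?thesis by auto
qed

text \<open>The witness is \<open>H ** A ** G\<close>, where \<open>G\<close> makes
  \<open>A ** G\<close> symmetric and \<open>H\<close> makes \<open>H ** A\<close> symmetric. Its
  products with \<open>A\<close> collapse to exactly these two matrices.\<close>

lemma is_pinv_exists:
  fixes A :: "real^'n^'m"
  shows "\<exists>P. is_pinv A P"
proof -
  obtain G where G: "A ** G ** A = A" "transpose (A ** G) = A ** G"
    using least_squares_inverse by blast
  \<comment> \<open>The mirror-image inverse \<open>H\<close> is the transpose of a least-squares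
    inverse of \<open>transpose A\<close>.\<close>
  obtain H' where H': "transpose A ** H' ** transpose A = transpose A"
      "transpose (transpose A ** H') = transpose A ** H'"
    using least_squares_inverse by blast
  define H where "H = transpose H'"
  have H: "A ** H ** A = A" "transpose (H ** A) = H ** A"
    using H' unfolding H_def by (metis matrix_mul_assoc matrix_transpose_mul transpose_transpose)+
  have AP: "A ** (H ** A ** G) = A ** G" by (simp only: matrix_mul_assoc H)
  have PA: "H ** A ** G ** A = H ** A" by (simp only: matrix_mul_assoc[symmetric]) (simp only: matrix_mul_assoc G)
  have "H ** A ** G ** A ** (H ** A ** G) = H ** (A ** H ** A) ** G"
    unfolding PA by (simp only: matrix_mul_assoc)
  then have "is_pinv A (H ** A ** G)"
    unfolding is_pinv_def AP PA by (simp add: G H)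
  then show ?thesis by blast
qed

text \<open>\<open>A ** P\<close> and \<open>A ** Q\<close> are symmetric projections with the same
  range, hence equal, and likewise on the other side. Then
  \<open>P = P ** A ** P = Q ** A ** Q = Q\<close>.\<close>

lemma is_pinv_unique:
  assumes P: "is_pinv A P" and Q: "is_pinv A Q"
  shows "P = Q"
proof -
  have "A ** P = transpose ((A ** Q ** A) ** P)"
    using P Q by (simp add: is_pinv_def)
  also have "\<dots> = transpose (A ** P) ** transpose (A ** Q)"
    by (simp only: matrix_transpose_mul matrix_mul_assoc)
  also have "\<dots> = (A ** P ** A) ** Q"
    using P Q by (simp add: is_pinv_def matrix_mul_assoc)
  finally have AP: "A ** P = A ** Q" using P by (simp add: is_pinv_def)
  have "P ** A = transpose (P ** (A ** Q ** A))"
    using P Q by (simp add: is_pinv_def)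
  also have "\<dots> = transpose (Q ** A) ** transpose (P ** A)"
    by (simp only: matrix_transpose_mul matrix_mul_assoc)
  also have "\<dots> = (Q ** A) ** (P ** A)"
    using P Q by (simp add: is_pinv_def)
  also have "\<dots> = Q ** (A ** P ** A)"
    by (simp only: matrix_mul_assoc)
  finally have PA: "P ** A = Q ** A" using P by (simp add: is_pinv_def)
  have "P = P ** A ** P" using P by (simp add: is_pinv_def)
  also have "\<dots> = Q ** (A ** P)" by (simp only: PA matrix_mul_assoc)
  also have "\<dots> = Q" using Q by (simp add: AP is_pinv_def matrix_mul_assoc)
  finally show ?thesis .
qed

lemma is_pinv_pinv: "is_pinv A (pinv A)"
  unfolding pinv_def using is_pinv_exists is_pinv_unique by (metis theI)

lemma pinv_eq_transpose:
  fixes A :: "real^'n^'m"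
  shows "pinv A = transpose A ** (transpose (pinv A) ** pinv A)"
    and "pinv A = (pinv A ** transpose (pinv A)) ** transpose A"
proof -
  have P: "pinv A ** A ** pinv A = pinv A"
      "transpose (A ** pinv A) = A ** pinv A" "transpose (pinv A ** A) = pinv A ** A"
    using is_pinv_pinv[of A] by (auto simp: is_pinv_def)
  have "transpose (pinv A ** A) ** pinv A = pinv A" by (simp add: P)
  then show "pinv A = transpose A ** (transpose (pinv A) ** pinv A)"
    by (simp only: matrix_transpose_mul matrix_mul_assoc)
  have "pinv A ** transpose (A ** pinv A) = pinv A" by (simp add: P matrix_mul_assoc)
  then show "pinv A = (pinv A ** transpose (pinv A)) ** transpose A"
    by (simp only: matrix_transpose_mul matrix_mul_assoc)
qed

text \<open>\<open>pinv A ** A\<close> is the orthogonal projection onto the row space of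
  \<open>A\<close>, so it fixes the columns of \<open>transpose A\<close>.\<close>

lemma pinv_mult_transpose:
  fixes A :: "real^'n^'m"
  shows "pinv A ** A ** transpose A = transpose A"
proof -
  have P: "A ** (pinv A ** A) = A" "transpose (pinv A ** A) = pinv A ** A"
    using is_pinv_pinv[of A] by (auto simp: is_pinv_def matrix_mul_assoc)
  have "transpose (pinv A ** A) ** transpose A = transpose A"
    by (subst matrix_transpose_mul[symmetric]) (simp only: P)
  then show ?thesis by (simp only: P)
qed

section \<open>Bounds by the spectral norm\<close>

lemma norm_matrix_vector_le: "norm (M *v x) \<le> spectral_norm M * norm (x :: real^'n)"
  unfolding spectral_norm_def by (intro onorm matrix_vector_mul_bounded_linear)

lemma spectral_norm_pos: "M \<noteq> 0 \<Longrightarrow> spectral_norm (M :: real^'n^'m) > 0"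
  unfolding spectral_norm_def
  by (subst onorm_pos_lt) (auto simp: matrix_vector_mul_bounded_linear matrix_eq)

lemma pinv_eq_0_iff: "pinv A = 0 \<longleftrightarrow> A = (0 :: real^'n^'m)"
  using is_pinv_pinv[of A] unfolding is_pinv_def
  by (metis times0_left times0_right)

subsection \<open>The equation \<open>AXB = C\<close>\<close>

lemma norm_vec_cols: "norm (vec_cols X) = norm (X :: real^'n^'m)"
proof -
  have "norm (vec_cols X) = sqrt (\<Sum>c\<in>UNIV. \<Sum>r\<in>UNIV. (X $ r $ c)\<^sup>2)"
    by (simp add: norm_vec_def L2_set_def vec_cols_def sum.cartesian_product case_prod_beta)
  then show ?thesis
    unfolding norm_matrix_Frobenius by (subst sum.swap) simp
qed

lemma norm_kron: "norm (kron M N) = norm M * norm N"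
  for M :: "real^'b^'a" and N :: "real^'d^'c"
proof -
  have pairs: "sum f UNIV = (\<Sum>x\<in>UNIV. \<Sum>y\<in>UNIV. f (x, y))"
    for f :: "'x::finite \<times> 'y::finite \<Rightarrow> real"
    by (simp add: sum.cartesian_product)
  have "(norm (kron M N))\<^sup>2 = (\<Sum>r\<in>UNIV. \<Sum>c\<in>UNIV. (M $ fst r $ fst c)\<^sup>2 * (N $ snd r $ snd c)\<^sup>2)"
    by (simp add: norm_matrix_Frobenius sum_nonneg kron_def power_mult_distrib)
  also have "\<dots> = (\<Sum>a\<in>UNIV. \<Sum>c\<in>UNIV. \<Sum>b\<in>UNIV. \<Sum>d\<in>UNIV. (M $ a $ b)\<^sup>2 * (N $ c $ d)\<^sup>2)"
    by (simp add: pairs)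
  also have "\<dots> = (\<Sum>a\<in>UNIV. \<Sum>b\<in>UNIV. (M $ a $ b)\<^sup>2) * (\<Sum>c\<in>UNIV. \<Sum>d\<in>UNIV. (N $ c $ d)\<^sup>2)"
    unfolding sum_product ..
  also have "\<dots> = (norm M * norm N)\<^sup>2"
    by (simp add: norm_matrix_Frobenius sum_nonneg power_mult_distrib)
  finally show ?thesis by (simp add: power2_eq_iff_nonneg)
qed

lemma norm_transpose: "norm (transpose M) = norm (M :: real^'n^'m)"
  unfolding norm_matrix_Frobenius by (subst sum.swap) (simp add: transpose_def)

lemma transpose_kron: "transpose (kron M N) = kron (transpose M) (transpose N)"
  by (simp add: kron_def transpose_def vec_eq_iff)

text \<open>Translates the hypothesis on the starting matrix into a matrix form that the updates
  visibly preserve.\<close>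

lemma vec_cols_in_range_kron_iff:
  fixes A :: "real^'p^'m" and B :: "real^'n^'q" and X :: "real^'q^'p"
  shows "vec_cols X \<in> range (\<lambda>y. kron B (transpose A) *v y)
    \<longleftrightarrow> (\<exists>Z. X = transpose A ** Z ** transpose B)"
proof
  assume "vec_cols X \<in> range (\<lambda>y. kron B (transpose A) *v y)"
  then obtain y where y: "vec_cols X = kron B (transpose A) *v y" by auto
  define Z :: "real^'n^'m" where "Z = (\<chi> i j. y $ (j, i))"
  have "vec_cols Z = y" by (simp add: vec_cols_def Z_def vec_eq_iff)
  then have "vec_cols X = vec_cols (transpose A ** Z ** transpose B)"
    unfolding vec_cols_sandwich y by simp
  then have "X = transpose A ** Z ** transpose B"
    by (simp add: vec_cols_def vec_eq_iff)
  then show "\<exists>Z. X = transpose A ** Z ** transpose B" by blast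
next
  assume "\<exists>Z. X = transpose A ** Z ** transpose B"
  then show "vec_cols X \<in> range (\<lambda>y. kron B (transpose A) *v y)"
    by (auto simp: vec_cols_sandwich)
qed

text \<open>The form of \<open>E\<close> puts \<open>vec_cols E\<close> into the row space of
  \<open>K = kron (transpose B) A\<close>, which \<open>pinv K ** K\<close> fixes. Hence
  \<open>pinv K\<close> recovers it from \<open>vec_cols (A ** E ** B)\<close>.\<close>

lemma norm_le_pinv_kron:
  fixes A :: "real^'p^'m" and B :: "real^'n^'q" and Z :: "real^'n^'m"
  assumes E: "E = transpose A ** Z ** transpose B"
  shows "norm E \<le> spectral_norm (pinv (kron (transpose B) A)) * norm (A ** E ** B)"
proof -
  let ?K = "kron (transpose B) A"
  have "vec_cols E = transpose ?K *v vec_cols Z"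
    unfolding E vec_cols_sandwich transpose_kron by simp
  then have "pinv ?K *v vec_cols (A ** E ** B) = vec_cols E"
    unfolding vec_cols_sandwich[of A]
    by (simp only: matrix_vector_mul_assoc matrix_mul_assoc pinv_mult_transpose)
  then show ?thesis
    by (metis norm_matrix_vector_le norm_vec_cols)
qed

lemma matrix_diff_ldistrib: "(A :: real^'n^'m) ** (B - C) = A ** B - A ** C"
  by (simp add: matrix_matrix_mult_def vec_eq_iff algebra_simps sum_subtractf)

lemma matrix_diff_rdistrib: "((A :: real^'n^'m) - B) ** C = A ** C - B ** C"
  by (simp add: matrix_matrix_mult_def vec_eq_iff algebra_simps sum_subtractf)

lemma matrix_add_rdistrib: "((A :: real^'n^'m) + B) ** C = A ** C + B ** C"
  by (simp add: matrix_matrix_mult_def vec_eq_iff algebra_simps sum.distrib)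

text \<open>The left factor moves across by reordering the sums. The right factor becomes a left
  factor after transposing both arguments.\<close>

lemma inner_sandwich:
  fixes P :: "real^'p^'m" and X :: "real^'q^'p" and Q :: "real^'n^'q" and Y :: "real^'n^'m"
  shows "inner (P ** X ** Q) Y = inner X (transpose P ** Y ** transpose Q)"
proof -
  have l: "inner (M ** N) L = inner N (transpose M ** L)"
    for M :: "real^'b^'a" and N :: "real^'c^'b" and L
  proof -
    have "inner (M ** N) L = (\<Sum>i\<in>UNIV. \<Sum>k\<in>UNIV. \<Sum>j\<in>UNIV. M $ i $ k * N $ k $ j * L $ i $ j)"
      unfolding inner_vec_def matrix_matrix_mult_def
      by (rule sum.cong[OF refl], subst sum.swap) (simp add: sum_distrib_right)
    also have "\<dots> = (\<Sum>k\<in>UNIV. \<Sum>j\<in>UNIV. \<Sum>i\<in>UNIV. M $ i $ k * N $ k $ j * L $ i $ j)"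
      by (subst sum.swap, rule sum.cong[OF refl], rule sum.swap)
    also have "\<dots> = inner N (transpose M ** L)"
      by (simp add: inner_vec_def matrix_matrix_mult_def transpose_def sum_distrib_left mult_ac)
    finally show ?thesis .
  qed
  have t: "inner (transpose M) (transpose N) = inner M N" for M N :: "real^'b^'a"
    unfolding inner_vec_def by (subst sum.swap) (simp add: transpose_def)
  have "inner (P ** X ** Q) Y = inner (transpose Q ** transpose (P ** X)) (transpose Y)"
    by (simp only: t flip: matrix_transpose_mul)
  also have "\<dots> = inner (transpose (P ** X)) (transpose (Y ** transpose Q))"
    by (simp only: l matrix_transpose_mul transpose_transpose)
  also have "\<dots> = inner X (transpose P ** (Y ** transpose Q))"
    by (simp only: t l)
  finally show ?thesis by (simp add: matrix_mul_assoc)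
qed

section \<open>The least-norm solution\<close>

lemma pinv_solution:
  assumes "\<exists>Y. A ** Y ** B = C"
  shows "A ** (pinv A ** C ** pinv B) ** B = C"
proof -
  obtain Y where "A ** Y ** B = C" using assms by blast
  then have "A ** (pinv A ** C ** pinv B) ** B
      = (A ** pinv A ** A) ** Y ** (B ** pinv B ** B)"
    by (auto simp: matrix_mul_assoc)
  with \<open>A ** Y ** B = C\<close> show ?thesis
    using is_pinv_pinv[of A] is_pinv_pinv[of B] by (simp add: is_pinv_def)
qed

lemma pinv_sandwich:
  "\<exists>Z. pinv A ** C ** pinv B = transpose A ** Z ** transpose B"
proof -
  let ?Z = "transpose (pinv A) ** pinv A ** C ** (pinv B ** transpose (pinv B))"
  have "pinv A ** C ** pinv B = transpose A ** (transpose (pinv A) ** pinv A) ** C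
      ** ((pinv B ** transpose (pinv B)) ** transpose B)"
    using pinv_eq_transpose(1)[of A] pinv_eq_transpose(2)[of B] by simp
  also have "\<dots> = transpose A ** ?Z ** transpose B"
    by (simp only: matrix_mul_assoc)
  finally show ?thesis by blast
qed

text \<open>\<open>S = pinv A ** C ** pinv B\<close> has the form
  \<open>transpose A ** Z ** transpose B\<close>, so it is orthogonal to the kernel of
  \<open>Y \<mapsto> A ** Y ** B\<close>. Every solution differs from \<open>S\<close> by an element
  of this kernel, and Pythagoras gives minimality and uniqueness together.\<close>

lemma least_norm_solution_iff:
  assumes "\<exists>Y. A ** Y ** B = C"
  shows "least_norm_solution A B C Y \<longleftrightarrow> Y = pinv A ** C ** pinv B"
proof -
  define S where "S = pinv A ** C ** pinv B"
  have S: "A ** S ** B = C" using pinv_solution[OF assms] by (simp add: S_def)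
  obtain Z where Z: "S = transpose A ** Z ** transpose B"
    using pinv_sandwich unfolding S_def by blast
  have pyth: "(norm Y)\<^sup>2 = (norm S)\<^sup>2 + (norm (Y - S))\<^sup>2" if "A ** Y ** B = C" for Y
  proof -
    have "A ** (Y - S) ** B = 0"
      by (simp add: matrix_diff_ldistrib matrix_diff_rdistrib S that)
    then have "inner (Y - S) S = 0"
      unfolding Z inner_sandwich[symmetric] by (simp flip: Z)
    then show ?thesis
      using norm_add_Pythagorean[of S "Y - S"] by (simp add: orthogonal_def inner_commute)
  qed
  have "norm S \<le> norm Y" if "A ** Y ** B = C" for Y
    by (rule power2_le_imp_le) (simp_all add: pyth[OF that])
  moreover have "Y = S" if "A ** Y ** B = C" "norm Y \<le> norm S" for Y
  proof -
    have "(norm (Y - S))\<^sup>2 \<le> 0"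
      using pyth[OF that(1)] power_mono[OF that(2), of 2] norm_ge_zero[of Y] by linarith
    then show ?thesis by simp
  qed
  ultimately show ?thesis
    unfolding least_norm_solution_def S_def[symmetric] using S by blast
qed

subsection \<open>One step of the iteration\<close>

definition rank_one :: "real^'a \<Rightarrow> real^'b \<Rightarrow> real^'b^'a" where
  "rank_one a b = (\<chi> i j. a $ i * b $ j)"

lemma columnvector_rowvector:
  "(columnvector a :: real^1^'a) ** rowvector b = rank_one a b"
  by (simp add: rank_one_def columnvector_def rowvector_def matrix_matrix_mult_def vec_eq_iff)

lemma rank_one_mult: "rank_one a b ** transpose (B :: real^'n^'q) = rank_one a (B *v b)"
  by (simp add: rank_one_def matrix_matrix_mult_def matrix_vector_mult_def transpose_def
      vec_eq_iff sum_distrib_left mult_ac)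

lemma mult_rank_one: "(P :: real^'n^'q) ** rank_one a b = rank_one (P *v a) b"
  by (simp add: rank_one_def matrix_matrix_mult_def matrix_vector_mult_def
      vec_eq_iff sum_distrib_left mult_ac)

lemma sandwich_scaleR: "P ** (c *\<^sub>R X) ** Q = c *\<^sub>R (P ** X ** Q)"
  for P :: "real^'p^'m" and Q :: "real^'n^'q"
  by (simp add: matrix_matrix_mult_def vec_eq_iff sum_distrib_left mult_ac)

lemma inner_rank_one: "inner E (rank_one a b) = inner a (E *v b)"
  by (simp add: rank_one_def inner_vec_def matrix_vector_mult_def sum_distrib_left mult_ac)

lemma norm_rank_one: "norm (rank_one a b) = norm a * norm (b :: real^'n)"
proof -
  have "rank_one a b *v b = inner b b *\<^sub>R a"
    by (simp add: rank_one_def matrix_vector_mult_def inner_vec_def vec_eq_iff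
        sum_distrib_left mult_ac)
  then have "(norm (rank_one a b))\<^sup>2 = (norm a * norm b)\<^sup>2"
    unfolding power2_norm_eq_inner inner_rank_one
    by (simp add: power_mult_distrib power2_norm_eq_inner)
  then show ?thesis by (simp add: power2_eq_iff_nonneg)
qed

text \<open>The increment of the iterate. The product of the column \<open>A $ i\<close>, the row
  \<open>R $ i\<close> and \<open>transpose B\<close> is the outer product of \<open>A $ i\<close>
  and \<open>B *v (R $ i)\<close>.\<close>

definition grbk_step ::
  "real^'p^'m \<Rightarrow> real^'n^'q \<Rightarrow> real \<Rightarrow> real^'n^'m \<Rightarrow> 'm \<Rightarrow> real^'q^'p" where
  "grbk_step A B \<alpha> R i = (\<alpha> / (norm (A $ i))\<^sup>2) *\<^sub>R rank_one (A $ i) (B *v (R $ i))"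

lemma grbk_step_0 [simp]: "grbk_step A B \<alpha> 0 i = 0"
  by (simp add: grbk_step_def rank_one_def vec_eq_iff)

text \<open>Since \<open>A $ i\<close> is \<open>transpose A\<close> applied to a unit vector, a
  suitable \<open>Z\<close> is a multiple of the matrix whose only possibly nonzero row is
  \<open>R $ i\<close>, in place \<open>i\<close>.\<close>

lemma grbk_step_in_range:
  "\<exists>Z. grbk_step A B \<alpha> R i = transpose A ** Z ** transpose B"
proof -
  have "transpose A *v axis i 1 = A $ i"
    by (simp only: matrix_vector_mult_basis column_transpose) (simp add: row_def vec_lambda_eta)
  then have "grbk_step A B \<alpha> R i
      = transpose A ** ((\<alpha> / (norm (A $ i))\<^sup>2) *\<^sub>R rank_one (axis i 1) (R $ i)) ** transpose B"
    by (simp only: grbk_step_def sandwich_scaleR mult_rank_one rank_one_mult)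
  then show ?thesis by blast
qed

text \<open>Column \<open>i\<close> of \<open>A ** transpose A\<close> is
  \<open>A *v (A $ i)\<close>, so the recursion for the residual subtracts exactly the image of the
  step under \<open>X \<mapsto> A ** X ** B\<close>.\<close>

lemma residual_update:
  fixes A :: "real^'p^'m" and B :: "real^'n^'q"
  shows "(\<alpha> / (norm (A $ i))\<^sup>2) *\<^sub>R
      ((columnvector (column i (A ** transpose A)) :: real^1^'m) ** rowvector r ** (transpose B ** B))
    = A ** ((\<alpha> / (norm (A $ i))\<^sup>2) *\<^sub>R rank_one (A $ i) (B *v r)) ** B"
proof -
  have "column i (A ** transpose A) = A *v (A $ i)"
    by (simp add: column_def matrix_matrix_mult_def matrix_vector_mult_def transpose_def vec_eq_iff)
  then show ?thesis
    by (simp only: columnvector_rowvector matrix_mul_assoc rank_one_mult sandwich_scaleR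
        mult_rank_one)
qed

text \<open>Expand the square. The cross term yields the gain \<open>2 * \<alpha>\<close>, and
  bounding \<open>B *v r\<close> by the spectral norm yields the loss
  \<open>\<alpha>^2 * (spectral_norm B)^2\<close>.\<close>

lemma grbk_step_error:
  fixes A :: "real^'p^'m" and B :: "real^'n^'q" and E :: "real^'q^'p"
  assumes R: "R = - (A ** E ** B)" and a: "A $ i \<noteq> 0"
  shows "(norm (E + grbk_step A B \<alpha> R i))\<^sup>2
    \<le> (norm E)\<^sup>2 - (2 * \<alpha> - \<alpha>\<^sup>2 * (spectral_norm B)\<^sup>2) * ((norm (R $ i))\<^sup>2 / (norm (A $ i))\<^sup>2)"
proof -
  define r w where "r = R $ i" and "w = (norm (A $ i))\<^sup>2"
  have w: "w > 0" using a by (simp add: w_def)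
  \<comment> \<open>The inner product is the \<open>i\<close>-th row of \<open>A ** E ** B\<close>
    paired with \<open>r\<close>, and that row is \<open>- r\<close>.\<close>
  have "inner E (rank_one (A $ i) (B *v r)) = ((A ** E ** B) *v r) $ i"
    by (simp only: inner_rank_one matrix_vector_mul_component[symmetric] matrix_vector_mul_assoc
        matrix_mul_assoc)
  also have "\<dots> = - (norm r)\<^sup>2"
    by (simp add: matrix_vector_mul_component r_def R power2_norm_eq_inner)
  finally have cross: "inner E (grbk_step A B \<alpha> R i) = - \<alpha> * (norm r)\<^sup>2 / w"
    by (simp add: grbk_step_def r_def w_def)
  have "norm (grbk_step A B \<alpha> R i) = \<bar>\<alpha> / w\<bar> * (norm (A $ i) * norm (B *v r))"
    by (simp add: grbk_step_def norm_rank_one r_def w_def)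
  then have "(norm (grbk_step A B \<alpha> R i))\<^sup>2 = (\<alpha> / w)\<^sup>2 * (w * (norm (B *v r))\<^sup>2)"
    by (simp only: power_mult_distrib power2_abs w_def)
  also have "\<dots> = \<alpha>\<^sup>2 / w * (norm (B *v r))\<^sup>2"
    using w by (simp add: power2_eq_square)
  also have "\<dots> \<le> \<alpha>\<^sup>2 / w * (spectral_norm B * norm r)\<^sup>2"
    using w by (intro mult_left_mono power_mono norm_matrix_vector_le) auto
  finally have square: "(norm (grbk_step A B \<alpha> R i))\<^sup>2 \<le> \<alpha>\<^sup>2 / w * (spectral_norm B * norm r)\<^sup>2" .
  have "(norm (E + grbk_step A B \<alpha> R i))\<^sup>2
      = (norm E)\<^sup>2 + 2 * inner E (grbk_step A B \<alpha> R i) + (norm (grbk_step A B \<alpha> R i))\<^sup>2"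
    by (simp add: power2_norm_eq_inner inner_add_left inner_add_right inner_commute)
  also have "\<dots> \<le> (norm E)\<^sup>2 + 2 * (- \<alpha> * (norm r)\<^sup>2 / w) + \<alpha>\<^sup>2 / w * (spectral_norm B * norm r)\<^sup>2"
    using square cross by simp
  also have "\<dots> = (norm E)\<^sup>2 - (2 * \<alpha> - \<alpha>\<^sup>2 * (spectral_norm B)\<^sup>2) * ((norm r)\<^sup>2 / w)"
    by (simp add: algebra_simps power_mult_distrib)
  finally show ?thesis unfolding r_def w_def .
qed

section \<open>Row norms and the greedy index set\<close>

lemma norm_power2_rows: "(norm A)\<^sup>2 = (\<Sum>i\<in>UNIV. (norm (A $ i))\<^sup>2)"
  for A :: "real^'n^'m"
  by (simp add: norm_vec_def[of A] L2_set_def sum_nonneg)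

lemma grbk_gamma_eq: "grbk_gamma A R = (\<Sum>i | R $ i \<noteq> 0. (norm (A $ i))\<^sup>2)"
  for R :: "real^'n^'m"
proof -
  have "- grbk_Omega R = {i. R $ i \<noteq> 0}" by (auto simp: grbk_Omega_def)
  moreover have "(norm A)\<^sup>2 = (\<Sum>i\<in>- grbk_Omega R. (norm (A $ i))\<^sup>2)
      + (\<Sum>i\<in>grbk_Omega R. (norm (A $ i))\<^sup>2)"
    unfolding norm_power2_rows by (subst sum.Int_Diff[of _ _ "- grbk_Omega R"]) (auto simp: Diff_eq)
  ultimately show ?thesis by (simp add: grbk_gamma_def)
qed

lemma grbk_gamma_pos:
  assumes "\<And>i. A $ i \<noteq> 0" and "R \<noteq> 0"
  shows "grbk_gamma A R > 0"
  unfolding grbk_gamma_eq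
  using assms by (intro sum_pos) (auto simp: vec_eq_iff)

lemma grbk_gamma_le: "grbk_gamma A R \<le> (norm A)\<^sup>2"
  unfolding grbk_gamma_def by (simp add: sum_nonneg)

text \<open>Only the nonzero rows of \<open>R\<close> contribute. Each is at most the maximal ratio
  times \<open>(norm (A $ i))^2\<close>, and these weights add up to
  \<open>grbk_gamma A R\<close>.\<close>

lemma norm_le_max_ratio:
  fixes R :: "real^'n^'m"
  assumes "\<And>i. A $ i \<noteq> 0"
  shows "(norm R)\<^sup>2 \<le> (MAX i. (norm (R $ i))\<^sup>2 / (norm (A $ i))\<^sup>2) * grbk_gamma A R"
proof -
  define m where "m = (MAX i. (norm (R $ i))\<^sup>2 / (norm (A $ i))\<^sup>2)"
  have m: "(norm (R $ i))\<^sup>2 \<le> m * (norm (A $ i))\<^sup>2" for i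
  proof -
    have "(norm (R $ i))\<^sup>2 / (norm (A $ i))\<^sup>2 \<le> m"
      unfolding m_def by (intro Max_ge) auto
    then show ?thesis using assms[of i] by (simp add: pos_divide_le_eq)
  qed
  have "(norm R)\<^sup>2 = (\<Sum>i | R $ i \<noteq> 0. (norm (R $ i))\<^sup>2)"
    unfolding norm_power2_rows by (rule sum.mono_neutral_right) auto
  also have "\<dots> \<le> (\<Sum>i | R $ i \<noteq> 0. m * (norm (A $ i))\<^sup>2)"
    by (intro sum_mono m)
  finally show ?thesis by (simp add: grbk_gamma_eq sum_distrib_left m_def)
qed

text \<open>Membership in \<open>grbk_J\<close> bounds the row ratio below by
  \<open>grbk_zeta A R * (norm R)^2\<close>. This is half the maximal ratio plus
  \<open>(norm R)^2 / (2 * (norm A)^2)\<close>, and the maximal ratio is at least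
  \<open>(norm R)^2 / grbk_gamma A R\<close>.\<close>

lemma grbk_J_ratio:
  fixes R :: "real^'n^'m"
  assumes rows: "\<And>i. A $ i \<noteq> 0" and R: "R \<noteq> 0" and i: "i \<in> grbk_J A R"
  shows "(1 / (2 * grbk_gamma A R) + 1 / (2 * (norm A)\<^sup>2)) * (norm R)\<^sup>2
    \<le> (norm (R $ i))\<^sup>2 / (norm (A $ i))\<^sup>2"
proof -
  define m where "m = (MAX i. (norm (R $ i))\<^sup>2 / (norm (A $ i))\<^sup>2)"
  have g: "grbk_gamma A R > 0" using rows R by (rule grbk_gamma_pos)
  have "(norm R)\<^sup>2 / grbk_gamma A R \<le> m"
    using norm_le_max_ratio[OF rows, of R] g by (simp add: m_def pos_divide_le_eq)
  then have "(1 / (2 * grbk_gamma A R) + 1 / (2 * (norm A)\<^sup>2)) * (norm R)\<^sup>2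
      \<le> m / 2 + (norm R)\<^sup>2 / (2 * (norm A)\<^sup>2)"
    by (simp add: distrib_right)
  also have "\<dots> = grbk_zeta A R * (norm R)\<^sup>2"
    using R by (simp add: grbk_zeta_def m_def[symmetric] field_simps)
  also have "\<dots> \<le> (norm (R $ i))\<^sup>2 / (norm (A $ i))\<^sup>2"
    using i rows[of i] by (simp add: grbk_J_def pos_le_divide_eq mult_ac)
  finally show ?thesis .
qed

section \<open>The contraction factors\<close>

lemma grbk_rho_eq:
  fixes A :: "real^'p^'m" and B :: "real^'n^'q"
  assumes "A \<noteq> 0" "B \<noteq> 0"
  shows "grbk_rho A B \<alpha> R = 1 - (2 * \<alpha> - \<alpha>\<^sup>2 * (spectral_norm B)\<^sup>2)
      * (1 / (2 * grbk_gamma A R) + 1 / (2 * (norm A)\<^sup>2))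
      / (spectral_norm (pinv (kron (transpose B) A)))\<^sup>2"
    and "grbk_rho0 A B \<alpha> = 1 - (2 * \<alpha> - \<alpha>\<^sup>2 * (spectral_norm B)\<^sup>2) * (1 / (norm A)\<^sup>2)
      / (spectral_norm (pinv (kron (transpose B) A)))\<^sup>2"
proof -
  \<comment> \<open>The Frobenius norm of the Kronecker product factors, so it cancels against the
    condition number and leaves only the spectral norm of the pseudoinverse.\<close>
  have n: "(norm (kron (transpose B) A))\<^sup>2 = (norm B)\<^sup>2 * (norm A)\<^sup>2"
    by (simp add: norm_kron norm_transpose power_mult_distrib)
  have phi: "grbk_phi A B R = (norm B)\<^sup>2 * (norm A)\<^sup>2 * (1 / (2 * grbk_gamma A R) + 1 / (2 * (norm A)\<^sup>2))"
    using assms by (simp add: grbk_phi_def n distrib_left)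
  show "grbk_rho A B \<alpha> R = 1 - (2 * \<alpha> - \<alpha>\<^sup>2 * (spectral_norm B)\<^sup>2)
      * (1 / (2 * grbk_gamma A R) + 1 / (2 * (norm A)\<^sup>2))
      / (spectral_norm (pinv (kron (transpose B) A)))\<^sup>2"
    unfolding grbk_rho_def cond_F2_def power_mult_distrib n phi using assms by simp
  show "grbk_rho0 A B \<alpha> = 1 - (2 * \<alpha> - \<alpha>\<^sup>2 * (spectral_norm B)\<^sup>2) * (1 / (norm A)\<^sup>2)
      / (spectral_norm (pinv (kron (transpose B) A)))\<^sup>2"
    unfolding grbk_rho0_def cond_F2_def power_mult_distrib n using assms by simp
qed

lemma grbk_rate_pos:
  assumes "0 < \<alpha>" "\<alpha> < 2 / (spectral_norm B)\<^sup>2"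
  shows "2 * \<alpha> - \<alpha>\<^sup>2 * (spectral_norm B)\<^sup>2 > 0"
proof -
  \<comment> \<open>Were it zero, the upper bound on \<open>\<alpha>\<close> would be
    \<open>2 / 0 = 0\<close>, contradicting \<open>0 < \<alpha>\<close>.\<close>
  have "(spectral_norm B)\<^sup>2 \<noteq> 0"
    using assms by auto
  then have "(spectral_norm B)\<^sup>2 > 0" by (simp add: zero_less_power2)
  then have "\<alpha> * (\<alpha> * (spectral_norm B)\<^sup>2) < \<alpha> * 2"
    using assms by (intro mult_strict_left_mono) (auto simp: pos_less_divide_eq)
  then show ?thesis by (simp add: power2_eq_square mult_ac)
qed

text \<open>The rate contains the mean of \<open>1 / grbk_gamma A R\<close> and
  \<open>1 / (norm A)^2\<close>, and \<open>grbk_gamma A R\<close> is at most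
  \<open>(norm A)^2\<close>. This replaces a random factor by a constant one.\<close>

lemma grbk_rho_le_rho0:
  fixes A :: "real^'p^'m" and B :: "real^'n^'q"
  assumes rows: "\<And>i. A $ i \<noteq> 0" and B: "B \<noteq> 0" and R: "R \<noteq> 0"
    and alpha: "0 < \<alpha>" "\<alpha> < 2 / (spectral_norm B)\<^sup>2"
  shows "grbk_rho A B \<alpha> R \<le> grbk_rho0 A B \<alpha>"
proof -
  have A: "A \<noteq> 0" using rows by (metis zero_index)
  have "1 / (norm A)\<^sup>2 \<le> 1 / grbk_gamma A R"
    using grbk_gamma_pos[OF rows R] grbk_gamma_le[of A R] A by (intro divide_left_mono) auto
  then have "1 / (norm A)\<^sup>2 \<le> 1 / (2 * grbk_gamma A R) + 1 / (2 * (norm A)\<^sup>2)"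
    by simp
  then show ?thesis
    unfolding grbk_rho_eq[OF A B] using grbk_rate_pos[OF alpha]
    by (intro diff_left_mono divide_right_mono mult_left_mono) auto
qed

lemma kron_eq_0_iff: "kron M N = 0 \<longleftrightarrow> M = 0 \<or> N = 0"
  for M :: "real^'b^'a" and N :: "real^'d^'c"
  using norm_kron[of M N] by (metis mult_eq_0_iff norm_eq_zero)

lemma grbk_rho0_less_1:
  fixes A :: "real^'p^'m" and B :: "real^'n^'q"
  assumes A: "A \<noteq> 0" and B: "B \<noteq> 0"
    and alpha: "0 < \<alpha>" "\<alpha> < 2 / (spectral_norm B)\<^sup>2"
  shows "grbk_rho0 A B \<alpha> < 1"
proof -
  have "transpose B \<noteq> 0" using B norm_transpose by (metis norm_eq_zero)
  then have "spectral_norm (pinv (kron (transpose B) A)) > 0"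
    using A by (intro spectral_norm_pos) (simp add: pinv_eq_0_iff kron_eq_0_iff)
  then show ?thesis
    unfolding grbk_rho_eq[OF A B] using grbk_rate_pos[OF alpha] A by simp
qed

lemma grbk_step_contraction:
  fixes A :: "real^'p^'m" and B :: "real^'n^'q" and Z :: "real^'n^'m"
  assumes rows: "\<And>i. A $ i \<noteq> 0" and B: "B \<noteq> 0"
    and alpha: "0 < \<alpha>" "\<alpha> < 2 / (spectral_norm B)\<^sup>2"
    and E: "E = transpose A ** Z ** transpose B"
    and R: "R = - (A ** E ** B)" "R \<noteq> 0" and i: "i \<in> grbk_J A R"
  shows "(norm (E + grbk_step A B \<alpha> R i))\<^sup>2 \<le> grbk_rho A B \<alpha> R * (norm E)\<^sup>2"
proof -
  define s where "s = spectral_norm (pinv (kron (transpose B) A))"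
  define d where "d = 2 * \<alpha> - \<alpha>\<^sup>2 * (spectral_norm B)\<^sup>2"
  define c where "c = 1 / (2 * grbk_gamma A R) + 1 / (2 * (norm A)\<^sup>2)"
  have A: "A \<noteq> 0" using rows by (metis zero_index)
  have c: "c \<ge> 0" using grbk_gamma_pos[OF rows R(2)] by (simp add: c_def)
  have d: "d > 0" using grbk_rate_pos[OF alpha] by (simp add: d_def)
  have "norm E \<le> s * norm R"
    using norm_le_pinv_kron[OF E] by (simp add: s_def R)
  then have "(norm E)\<^sup>2 \<le> s\<^sup>2 * (norm R)\<^sup>2"
    by (metis norm_ge_zero power_mono power_mult_distrib)
  \<comment> \<open>For \<open>s = 0\<close> the quotient is \<open>0\<close> by the convention on
    division, and the bound is trivial.\<close>
  then have "(norm E)\<^sup>2 / s\<^sup>2 \<le> (norm R)\<^sup>2"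
    by (cases "s = 0") (auto simp: pos_divide_le_eq mult_ac)
  then have "d * (c * ((norm E)\<^sup>2 / s\<^sup>2)) \<le> d * (c * (norm R)\<^sup>2)"
    using c d by (intro mult_left_mono) auto
  also have "\<dots> \<le> d * ((norm (R $ i))\<^sup>2 / (norm (A $ i))\<^sup>2)"
    using grbk_J_ratio[OF rows R(2) i] d by (intro mult_left_mono) (auto simp: c_def)
  finally have "d * (c * ((norm E)\<^sup>2 / s\<^sup>2)) \<le> d * ((norm (R $ i))\<^sup>2 / (norm (A $ i))\<^sup>2)" .
  moreover have "grbk_rho A B \<alpha> R * (norm E)\<^sup>2 = (norm E)\<^sup>2 - d * (c * ((norm E)\<^sup>2 / s\<^sup>2))"
    unfolding grbk_rho_eq[OF A B] s_def[symmetric] d_def[symmetric] c_def[symmetric]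
    by (simp add: left_diff_distrib)
  ultimately show ?thesis
    using grbk_step_error[OF R(1) rows, of \<alpha> i] by (simp add: d_def)
qed

subsection \<open>Random variables determined by the past\<close>

text \<open>Factoring through the list of the first \<open>k\<close> indices makes measurability
  automatic, as lists carry the discrete sigma-algebra. For a finite index type it also leaves only
  finitely many values.\<close>

definition past_determined ::
  "'w measure \<Rightarrow> (nat \<Rightarrow> 'w \<Rightarrow> 'm) \<Rightarrow> nat \<Rightarrow> ('w \<Rightarrow> 'a) \<Rightarrow> bool" where
  "past_determined M I k f \<longleftrightarrow> (\<exists>h. \<forall>\<omega>\<in>space M. f \<omega> = h (map (\<lambda>s. I s \<omega>) [0..<k]))"

lemma past_determined_const: "past_determined M I k (\<lambda>_. c)"
  unfolding past_determined_def by (intro exI[of _ "\<lambda>_. c"]) simp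

lemma past_determined_index: "past_determined M I (Suc k) (I k)"
  unfolding past_determined_def by (intro exI[of _ last]) simp

lemma past_determined_comp: "past_determined M I k f \<Longrightarrow> past_determined M I k (\<lambda>\<omega>. g (f \<omega>))"
  unfolding past_determined_def by (elim exE, rule_tac x = "g \<circ> h" in exI) simp

lemma past_determined_comp2:
  assumes "past_determined M I k f" "past_determined M I k f'"
  shows "past_determined M I k (\<lambda>\<omega>. g (f \<omega>) (f' \<omega>))"
proof -
  obtain h h' where "\<forall>\<omega>\<in>space M. f \<omega> = h (map (\<lambda>s. I s \<omega>) [0..<k])"
      "\<forall>\<omega>\<in>space M. f' \<omega> = h' (map (\<lambda>s. I s \<omega>) [0..<k])"
    using assms unfolding past_determined_def by blast
  then show ?thesis
    unfolding past_determined_def by (intro exI[of _ "\<lambda>xs. g (h xs) (h' xs)"]) simp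
qed

lemma past_determined_mono:
  assumes "past_determined M I j f" "j \<le> k"
  shows "past_determined M I k f"
proof -
  obtain h where h: "\<forall>\<omega>\<in>space M. f \<omega> = h (map (\<lambda>s. I s \<omega>) [0..<j])"
    using assms(1) unfolding past_determined_def by blast
  show ?thesis
    unfolding past_determined_def using h assms(2)
    by (intro exI[of _ "\<lambda>xs. h (take j xs)"]) (simp add: take_map min_def)
qed

lemma past_determined_prod:
  fixes f :: "'b \<Rightarrow> 'w \<Rightarrow> real"
  assumes "\<And>l. l \<in> L \<Longrightarrow> past_determined M I k (f l)"
  shows "past_determined M I k (\<lambda>\<omega>. \<Prod>l\<in>L. f l \<omega>)"
  using assms
proof (induction L rule: infinite_finite_induct)
  case (insert l L)
  then have "past_determined M I k (\<lambda>\<omega>. f l \<omega> * (\<Prod>l\<in>L. f l \<omega>))"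
    by (intro past_determined_comp2[of _ _ _ _ _ "(*)"]) auto
  with insert.hyps show ?case by simp
qed (simp_all add: past_determined_const)

lemma space_past [simp]: "space (past M I k) = space M"
  by (simp add: past_def)

lemma past_determined_measurable:
  assumes "past_determined M I k f" "\<And>\<omega>. f \<omega> \<in> space N"
  shows "f \<in> measurable (past M I k) N"
proof -
  obtain h where h: "\<forall>\<omega>\<in>space M. f \<omega> = h (map (\<lambda>s. I s \<omega>) [0..<k])"
    using assms(1) unfolding past_determined_def by blast
  have "(\<lambda>\<omega>. map (\<lambda>s. I s \<omega>) [0..<k]) \<in> measurable (past M I k) (count_space UNIV)"
    unfolding past_def by (rule measurable_vimage_algebra1) simp
  moreover have "(\<lambda>xs. if h xs \<in> space N then h xs else f undefined) \<in> measurable (count_space UNIV) N"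
    using assms(2) by simp
  ultimately have "(\<lambda>\<omega>. (\<lambda>xs. if h xs \<in> space N then h xs else f undefined)
      (map (\<lambda>s. I s \<omega>) [0..<k])) \<in> measurable (past M I k) N"
    by (rule measurable_compose)
  moreover have "f \<omega> = (\<lambda>xs. if h xs \<in> space N then h xs else f undefined)
      (map (\<lambda>s. I s \<omega>) [0..<k])" if "\<omega> \<in> space (past M I k)" for \<omega>
    using that h assms(2)[of \<omega>] by simp
  ultimately show ?thesis by (subst measurable_cong)
qed

text \<open>Lists over a finite type are countable, so preimages of singletons suffice. These are
  finite intersections of events about single indices.\<close>

lemma subalgebra_past:
  fixes I :: "nat \<Rightarrow> 'w \<Rightarrow> 'm::finite"
  assumes I: "\<And>k. I k \<in> measurable M (count_space UNIV)"
  shows "subalgebra M (past M I k)"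
proof -
  have "(\<lambda>\<omega>. map (\<lambda>s. I s \<omega>) [0..<k]) \<in> measurable M (count_space UNIV)"
    unfolding measurable_count_space_eq2_countable
  proof (intro conjI ballI)
    fix xs :: "'m list"
    have "(\<lambda>\<omega>. map (\<lambda>s. I s \<omega>) [0..<k]) -` {xs} \<inter> space M
        = (if length xs = k then {\<omega>\<in>space M. \<forall>s\<in>{..<k}. I s \<omega> = xs ! s} else {})"
      by (auto simp: list_eq_iff_nth_eq[of _ xs])
    also have "\<dots> \<in> sets M"
    proof -
      have "{\<omega>\<in>space M. I s \<omega> = xs ! s} \<in> sets M" for s
        using measurable_sets[OF I[of s], of "{xs ! s}"]
        by (simp add: vimage_def Int_def conj_commute)
      then have "{\<omega>\<in>space M. \<forall>s\<in>{..<k}. I s \<omega> = xs ! s} \<in> sets M"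
        by (intro sets.sets_Collect_finite_All) auto
      then show ?thesis by simp
    qed
    finally show "(\<lambda>\<omega>. map (\<lambda>s. I s \<omega>) [0..<k]) -` {xs} \<inter> space M \<in> sets M" .
  qed auto
  then have "sets (past M I k) \<subseteq> sets M"
    unfolding past_def by (intro sets_image_in_sets) simp_all
  then show ?thesis by (simp add: subalgebra_def)
qed

text \<open>Only finitely many index lists of length \<open>k\<close> exist, so \<open>f\<close> is
  bounded.\<close>

lemma past_determined_integrable:
  fixes I :: "nat \<Rightarrow> 'w \<Rightarrow> 'm::finite" and f :: "'w \<Rightarrow> real"
  assumes "prob_space M" and I: "\<And>k. I k \<in> measurable M (count_space UNIV)"
    and f: "past_determined M I k f"
  shows "integrable M f"
proof -
  interpret prob_space M by fact
  obtain h where h: "\<forall>\<omega>\<in>space M. f \<omega> = h (map (\<lambda>s. I s \<omega>) [0..<k])"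
    using f unfolding past_determined_def by blast
  define H where "H = h ` {xs. set xs \<subseteq> (UNIV :: 'm set) \<and> length xs = k}"
  have "finite H" unfolding H_def by (intro finite_imageI finite_lists_length_eq finite)
  moreover have "f \<omega> \<in> H" if "\<omega> \<in> space M" for \<omega>
    using h that by (auto simp: H_def)
  ultimately have "\<bar>f \<omega>\<bar> \<le> Max (abs ` H)" if "\<omega> \<in> space M" for \<omega>
    using that by (intro Max_ge) auto
  moreover have "f \<in> borel_measurable M"
    by (rule measurable_from_subalg[OF subalgebra_past[OF I] past_determined_measurable[OF f]]) simp
  ultimately show ?thesis
    by (intro integrable_const_bound[where B = "Max (abs ` H)"] AE_I2) auto
qed

subsection \<open>The ME-GRBK process\<close>

lemma me_grbk_D:
  fixes A :: "real^'p^'m" and B :: "real^'n^'q"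
  assumes "me_grbk M A B C \<alpha> X0 I X R"
  shows "prob_space M" and "I k \<in> measurable M (count_space UNIV)"
    and "\<omega> \<in> space M \<Longrightarrow> X 0 \<omega> = X0"
    and "\<omega> \<in> space M \<Longrightarrow> X (Suc k) \<omega> = X k \<omega> + grbk_step A B \<alpha> (R k \<omega>) (I k \<omega>)"
    and "AE \<omega> in M. R k \<omega> \<noteq> 0 \<longrightarrow>
        real_cond_exp M (past M I k) (indicator {\<omega>\<in>space M. I k \<omega> = i}) \<omega> = grbk_prob A (R k \<omega>) i"
  using assms unfolding me_grbk_def
  by (auto simp: Let_def columnvector_rowvector rank_one_mult grbk_step_def)

lemma me_grbk_residual:
  fixes A :: "real^'p^'m" and B :: "real^'n^'q"
  assumes "me_grbk M A B C \<alpha> X0 I X R" and \<omega>: "\<omega> \<in> space M"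
  shows "R k \<omega> = C - A ** X k \<omega> ** B"
proof (induction k)
  case 0
  then show ?case using assms by (auto simp: me_grbk_def)
next
  case (Suc k)
  have "R (Suc k) \<omega> = R k \<omega> - A ** grbk_step A B \<alpha> (R k \<omega>) (I k \<omega>) ** B"
    using assms unfolding me_grbk_def
    by (simp only: Let_def residual_update grbk_step_def)
  then show ?case
    using Suc me_grbk_D(4)[OF assms]
    by (simp add: matrix_add_ldistrib matrix_add_rdistrib)
qed

text \<open>The induction runs on \<open>X\<close> alone, because \<open>R k\<close> is a function
  of \<open>X k\<close>.\<close>

lemma me_grbk_past_determined:
  assumes P: "me_grbk M A B C \<alpha> X0 I X R"
  shows "past_determined M I k (X k)" and "past_determined M I k (R k)"
proof -
  have cong: "past_determined M I k f" if "past_determined M I k g" "\<And>\<omega>. \<omega> \<in> space M \<Longrightarrow> f \<omega> = g \<omega>"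
    for k f g using that unfolding past_determined_def by simp
  have R: "past_determined M I k (R k)" if "past_determined M I k (X k)" for k
    by (rule cong[OF past_determined_comp[OF that, of "\<lambda>x. C - A ** x ** B"] me_grbk_residual[OF P]])
  show X: "past_determined M I k (X k)" for k
  proof (induction k)
    case 0
    show ?case by (rule cong[OF past_determined_const me_grbk_D(3)[OF P]])
  next
    case (Suc k)
    have "past_determined M I (Suc k) (\<lambda>\<omega>. X k \<omega> + grbk_step A B \<alpha> (R k \<omega>) (I k \<omega>))"
      using past_determined_mono[OF Suc, of "Suc k"] past_determined_mono[OF R[OF Suc], of "Suc k"]
      by (intro past_determined_comp2[of _ _ _ _ _ "(+)"]
          past_determined_comp2[of _ _ _ _ _ "grbk_step A B \<alpha>"] past_determined_index) auto
    then show ?case by (rule cong[OF _ me_grbk_D(4)[OF P]])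
  qed
  show "past_determined M I k (R k)" by (rule R[OF X])
qed

text \<open>For fixed \<open>i\<close>, let \<open>f\<close> indicate the past event that
  \<open>i\<close> is inadmissible and \<open>g\<close> the choice of \<open>i\<close>. Then
  \<open>f * g\<close> has the same integral as \<open>f\<close> times the conditional expectation
  of \<open>g\<close>, which is zero. Being nonnegative, \<open>f * g\<close> vanishes almost
  surely, and there are finitely many \<open>i\<close>.\<close>

lemma me_grbk_index_in_J:
  fixes A :: "real^'p^'m"
  assumes P: "me_grbk M A B C \<alpha> X0 I X R"
  shows "AE \<omega> in M. R k \<omega> \<noteq> 0 \<longrightarrow> I k \<omega> \<in> grbk_J A (R k \<omega>)"
proof -
  interpret prob_space M by (rule me_grbk_D(1)[OF P])
  note [measurable] = me_grbk_D(2)[OF P]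
  interpret finite_measure_subalgebra M "past M I k"
    by unfold_locales (rule subalgebra_past[OF me_grbk_D(2)[OF P]])
  have "AE \<omega> in M. R k \<omega> \<noteq> 0 \<longrightarrow> i \<notin> grbk_J A (R k \<omega>) \<longrightarrow> I k \<omega> \<noteq> i" for i
  proof -
    define f :: "'a \<Rightarrow> real" where
      "f \<omega> = (if R k \<omega> \<noteq> 0 \<and> i \<notin> grbk_J A (R k \<omega>) then 1 else 0)" for \<omega>
    define g :: "'a \<Rightarrow> real" where "g = indicator {\<omega>\<in>space M. I k \<omega> = i}"
    have f: "f \<in> borel_measurable (past M I k)"
      unfolding f_def
      by (rule past_determined_measurable[OF past_determined_comp[OF me_grbk_past_determined(2)[OF P]]]) simp
    have [measurable]: "f \<in> borel_measurable M" "g \<in> borel_measurable M"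
      using measurable_from_subalg[OF subalg f] by (simp_all add: g_def)
    have fg: "integrable M (\<lambda>\<omega>. f \<omega> * g \<omega>)"
    proof (rule integrable_const_bound[where B = 1])
      show "AE \<omega> in M. norm (f \<omega> * g \<omega>) \<le> 1"
        by (rule AE_I2) (simp add: f_def g_def indicator_def)
    qed measurable
    \<comment> \<open>An inadmissible row of \<open>grbk_Rtilde\<close> is zero, hence so is its
      probability.\<close>
    have "AE \<omega> in M. f \<omega> * real_cond_exp M (past M I k) g \<omega> = 0"
      using me_grbk_D(5)[OF P, of k i]
      by eventually_elim (auto simp: f_def g_def grbk_prob_def grbk_Rtilde_def)
    then have "(\<integral>\<omega>. f \<omega> * real_cond_exp M (past M I k) g \<omega> \<partial>M) = 0"
      by (rule integral_eq_zero_AE)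
    then have "(\<integral>\<omega>. f \<omega> * g \<omega> \<partial>M) = 0"
      using real_cond_exp_intg(2)[OF fg f] by simp
    then have "AE \<omega> in M. f \<omega> * g \<omega> = 0"
      by (subst (asm) integral_nonneg_eq_0_iff_AE[OF fg]) (auto simp: f_def g_def indicator_def)
    then show ?thesis
      using AE_space by eventually_elim (auto simp: f_def g_def split: if_splits)
  qed
  then have "AE \<omega> in M. \<forall>i. R k \<omega> \<noteq> 0 \<longrightarrow> i \<notin> grbk_J A (R k \<omega>) \<longrightarrow> I k \<omega> \<noteq> i"
    by (subst AE_all_countable) blast
  then show ?thesis by eventually_elim blast
qed

theorem theorem4p2:
  fixes A :: "real^'p^'m" and B :: "real^'n^'q" and C :: "real^'n^'m"
    and \<alpha> :: real
    and X0 Xs :: "real^'q^'p"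
    and M :: "'w measure"
    and I :: "nat \<Rightarrow> 'w \<Rightarrow> 'm"
    and X :: "nat \<Rightarrow> 'w \<Rightarrow> real^'q^'p"
    and R :: "nat \<Rightarrow> 'w \<Rightarrow> real^'n^'m"
  assumes rows_nonzero: "\<And>i. A $ i \<noteq> 0"
    and B_nonzero: "B \<noteq> 0"
    and consistent: "\<exists>Y. A ** Y ** B = C"
    and alpha: "0 < \<alpha>" "\<alpha> < 2 / (spectral_norm B)\<^sup>2"
    and start: "vec_cols X0 \<in> range (\<lambda>y. kron B (transpose A) *v y)"
    and process: "me_grbk M A B C \<alpha> X0 I X R"
    and Xs: "Xs = pinv A ** C ** pinv B"
  shows "(\<forall>Y. least_norm_solution A B C Y \<longleftrightarrow> Y = Xs)
    \<and> (\<lambda>k. \<integral>\<omega>. (norm (X k \<omega> - Xs))\<^sup>2 \<partial>M) \<longlonglongrightarrow> 0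
    \<and> (\<integral>\<omega>. (norm (X 1 \<omega> - Xs))\<^sup>2 \<partial>M) \<le> grbk_rho0 A B \<alpha> * (norm (X0 - Xs))\<^sup>2
    \<and> (\<forall>k\<ge>1. AE \<omega> in M. R k \<omega> \<noteq> 0 \<longrightarrow>
          real_cond_exp M (past M I k) (\<lambda>\<omega>'. (norm (X (Suc k) \<omega>' - Xs))\<^sup>2) \<omega>
            \<le> grbk_rho A B \<alpha> (R k \<omega>) * (norm (X k \<omega> - Xs))\<^sup>2)
    \<and> (\<forall>k. (\<integral>\<omega>. (norm (X (Suc k) \<omega> - Xs))\<^sup>2 \<partial>M)
          \<le> (\<integral>\<omega>. (\<Prod>l\<le>k. grbk_factor A B \<alpha> (\<lambda>j. R j \<omega>) l) \<partial>M) * (norm (X0 - Xs))\<^sup>2)"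
proof -

  \<comment> \<open>Shape of the errors, stopping, and almost sure contraction\<close>
  interpret prob_space M by (rule me_grbk_D(1)[OF process])
  have A: "A \<noteq> 0" using rows_nonzero by (metis zero_index)
  have sol: "A ** Xs ** B = C" using pinv_solution[OF consistent] by (simp add: Xs)
  define e where "e k \<omega> = (norm (X k \<omega> - Xs))\<^sup>2" for k \<omega>
  define e0 where "e0 = (norm (X0 - Xs))\<^sup>2"
  have e_0: "e 0 \<omega> = e0" if "\<omega> \<in> space M" for \<omega>
    using me_grbk_D(3)[OF process that] by (simp add: e_def e0_def)
  have e_nonneg: "e k \<omega> \<ge> 0" for k \<omega> by (simp add: e_def)
  have R: "R k \<omega> = - (A ** (X k \<omega> - Xs) ** B)" if "\<omega> \<in> space M" for k \<omega>
    using me_grbk_residual[OF process that] sol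
    by (simp add: matrix_diff_ldistrib matrix_diff_rdistrib)
  \<comment> \<open>This form is invariant: \<open>X0\<close> has it by hypothesis,
    \<open>Xs\<close> by \<open>pinv_sandwich\<close>, and every step has it.\<close>
  have range: "\<exists>Z. X k \<omega> - Xs = transpose A ** Z ** transpose B" if "\<omega> \<in> space M" for k \<omega>
  proof (induction k)
    case 0
    obtain Z Z' where "X0 = transpose A ** Z ** transpose B" "Xs = transpose A ** Z' ** transpose B"
      using start pinv_sandwich[of A C B] unfolding vec_cols_in_range_kron_iff Xs by blast
    then have "X 0 \<omega> - Xs = transpose A ** (Z - Z') ** transpose B"
      using me_grbk_D(3)[OF process that] by (simp add: matrix_diff_ldistrib matrix_diff_rdistrib)
    then show ?case by blast
  next
    case (Suc k)
    then obtain Z where Z: "X k \<omega> - Xs = transpose A ** Z ** transpose B" by blast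
    obtain Z' where Z': "grbk_step A B \<alpha> (R k \<omega>) (I k \<omega>) = transpose A ** Z' ** transpose B"
      using grbk_step_in_range by blast
    have "X (Suc k) \<omega> - Xs = (X k \<omega> - Xs) + grbk_step A B \<alpha> (R k \<omega>) (I k \<omega>)"
      using me_grbk_D(4)[OF process that] by simp
    also have "\<dots> = transpose A ** (Z + Z') ** transpose B"
      by (simp add: Z Z' matrix_add_ldistrib matrix_add_rdistrib)
    finally show ?case by blast
  qed
  \<comment> \<open>On this range the residual controls the error, so a zero residual means that
    \<open>Xs\<close> has been reached.\<close>
  have stopped: "e k \<omega> = 0" if \<omega>: "\<omega> \<in> space M" and 0: "R k \<omega> = 0" for k \<omega>
  proof -
    obtain Z where Z: "X k \<omega> - Xs = transpose A ** Z ** transpose B" using range[OF \<omega>] by blast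
    have "A ** (X k \<omega> - Xs) ** B = 0" using R[OF \<omega>, of k] 0 by simp
    then show ?thesis using norm_le_pinv_kron[OF Z] by (simp add: e_def)
  qed
  have stopped_Suc: "e (Suc k) \<omega> = 0" if "\<omega> \<in> space M" "R k \<omega> = 0" for k \<omega>
    using stopped[OF that] me_grbk_D(4)[OF process that(1), of k] that(2)
    by (simp add: e_def)
  have contraction: "AE \<omega> in M. R k \<omega> \<noteq> 0 \<longrightarrow> e (Suc k) \<omega> \<le> grbk_rho A B \<alpha> (R k \<omega>) * e k \<omega>" for k
    using me_grbk_index_in_J[OF process, of k] AE_space
  proof eventually_elim
    case (elim \<omega>)
    obtain Z where Z: "X k \<omega> - Xs = transpose A ** Z ** transpose B" using range[OF elim(2)] by blast
    have X_Suc: "X (Suc k) \<omega> - Xs = (X k \<omega> - Xs) + grbk_step A B \<alpha> (R k \<omega>) (I k \<omega>)"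
      using me_grbk_D(4)[OF process elim(2)] by simp
    show ?case
      unfolding e_def X_Suc
      using grbk_step_contraction[OF rows_nonzero B_nonzero alpha Z R[OF elim(2)]] elim(1) by blast
  qed
  \<comment> \<open>A nonrandom factor that also covers stopped trajectories, where both errors are
    zero.\<close>
  have contraction0: "AE \<omega> in M. e (Suc k) \<omega> \<le> grbk_rho0 A B \<alpha> * e k \<omega>" for k
    using contraction[of k] AE_space
  proof eventually_elim
    case (elim \<omega>)
    show ?case
    proof (cases "R k \<omega> = 0")
      case True
      then show ?thesis using stopped stopped_Suc elim(2) by simp
    next
      case False
      have "grbk_rho A B \<alpha> (R k \<omega>) * e k \<omega> \<le> grbk_rho0 A B \<alpha> * e k \<omega>"
        by (intro mult_right_mono grbk_rho_le_rho0[OF rows_nonzero B_nonzero False alpha] e_nonneg)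
      with elim(1) False show ?thesis by linarith
    qed
  qed
  have e_det: "past_determined M I k (e k)" for k
    unfolding e_def by (rule past_determined_comp[OF me_grbk_past_determined(1)[OF process]])
  have integrable: "integrable M f" if "past_determined M I k f" for f :: "'w \<Rightarrow> real" and k
    by (rule past_determined_integrable[OF me_grbk_D(1,2)[OF process] that])
  note e_int = integrable[OF e_det]

  \<comment> \<open>Convergence in expectation and the first step\<close>
  have geometric: "(\<integral>\<omega>. e k \<omega> \<partial>M) \<le> max 0 (grbk_rho0 A B \<alpha>) ^ k * e0" for k
  proof (induction k)
    case 0
    have "(\<integral>\<omega>. e 0 \<omega> \<partial>M) = (\<integral>\<omega>. e0 \<partial>M)" by (rule Bochner_Integration.integral_cong) (simp_all add: e_0)
    then show ?case by (simp add: prob_space)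
  next
    case (Suc k)
    \<comment> \<open>Truncating at \<open>0\<close> makes the factor nonnegative, so the induction
      hypothesis can be multiplied by it without settling the sign of
      \<open>grbk_rho0 A B \<alpha>\<close>.\<close>
    have "(\<integral>\<omega>. e (Suc k) \<omega> \<partial>M) \<le> (\<integral>\<omega>. max 0 (grbk_rho0 A B \<alpha>) * e k \<omega> \<partial>M)"
    proof (rule integral_mono_AE[OF e_int])
      show "AE \<omega> in M. e (Suc k) \<omega> \<le> max 0 (grbk_rho0 A B \<alpha>) * e k \<omega>"
        using contraction0[of k]
      proof eventually_elim
        case (elim \<omega>)
        also have "grbk_rho0 A B \<alpha> * e k \<omega> \<le> max 0 (grbk_rho0 A B \<alpha>) * e k \<omega>"
          by (intro mult_right_mono e_nonneg) simp
        finally show ?case .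
      qed
    qed (simp add: e_int)
    also have "\<dots> = max 0 (grbk_rho0 A B \<alpha>) * (\<integral>\<omega>. e k \<omega> \<partial>M)" by simp
    also have "\<dots> \<le> max 0 (grbk_rho0 A B \<alpha>) * (max 0 (grbk_rho0 A B \<alpha>) ^ k * e0)"
      by (intro mult_left_mono Suc) simp
    finally show ?case by (simp add: mult_ac)
  qed
  have limit: "(\<lambda>k. \<integral>\<omega>. e k \<omega> \<partial>M) \<longlonglongrightarrow> 0"
  proof (rule tendsto_sandwich)
    show "\<forall>\<^sub>F k in sequentially. 0 \<le> (\<integral>\<omega>. e k \<omega> \<partial>M)"
      by (simp add: e_nonneg)
    show "\<forall>\<^sub>F k in sequentially. (\<integral>\<omega>. e k \<omega> \<partial>M) \<le> max 0 (grbk_rho0 A B \<alpha>) ^ k * e0"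
      by (intro always_eventually allI geometric)
    show "(\<lambda>k. max 0 (grbk_rho0 A B \<alpha>) ^ k * e0) \<longlonglongrightarrow> 0"
      using grbk_rho0_less_1[OF A B_nonzero alpha]
      by (intro tendsto_mult_left_zero LIMSEQ_power_zero) simp
  qed (rule tendsto_const)

  have first: "(\<integral>\<omega>. e 1 \<omega> \<partial>M) \<le> grbk_rho0 A B \<alpha> * e0"
  proof -
    have "(\<integral>\<omega>. e 1 \<omega> \<partial>M) \<le> (\<integral>\<omega>. grbk_rho0 A B \<alpha> * e0 \<partial>M)"
    proof (rule integral_mono_AE[OF e_int])
      show "AE \<omega> in M. e 1 \<omega> \<le> grbk_rho0 A B \<alpha> * e0"
        using contraction0[of 0] AE_space by eventually_elim (simp add: e_0)
    qed simp
    then show ?thesis by (simp add: prob_space)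
  qed

  have conditional: "AE \<omega> in M. R k \<omega> \<noteq> 0 \<longrightarrow>
      real_cond_exp M (past M I k) (e (Suc k)) \<omega> \<le> grbk_rho A B \<alpha> (R k \<omega>) * e k \<omega>" for k
  proof -
    interpret finite_measure_subalgebra M "past M I k"
      by unfold_locales (rule subalgebra_past[OF me_grbk_D(2)[OF process]])
    \<comment> \<open>The bound is set to \<open>0\<close> on stopped trajectories, where the next
      error is zero too. It then dominates almost everywhere, and being determined by the past it
      equals its own conditional expectation.\<close>
    define b where "b \<omega> = (if R k \<omega> = 0 then 0 else grbk_rho A B \<alpha> (R k \<omega>) * e k \<omega>)" for \<omega>
    have b: "past_determined M I k b"
      unfolding b_def by (rule past_determined_comp2[OF me_grbk_past_determined(2)[OF process] e_det])
    have "AE \<omega> in M. e (Suc k) \<omega> \<le> b \<omega>"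
      using contraction[of k] AE_space by eventually_elim (auto simp: b_def stopped_Suc)
    then have "AE \<omega> in M. real_cond_exp M (past M I k) (e (Suc k)) \<omega> \<le> real_cond_exp M (past M I k) b \<omega>"
      by (intro real_cond_exp_mono e_int integrable[OF b])
    moreover have "AE \<omega> in M. real_cond_exp M (past M I k) b \<omega> = b \<omega>"
      by (intro real_cond_exp_F_meas integrable[OF b] past_determined_measurable[OF b]) simp
    ultimately show ?thesis
      by eventually_elim (auto simp: b_def)
  qed

  \<comment> \<open>The bound by the product of random factors\<close>
  have product: "(\<integral>\<omega>. e (Suc k) \<omega> \<partial>M) \<le> (\<integral>\<omega>. (\<Prod>l\<le>k. grbk_factor A B \<alpha> (\<lambda>j. R j \<omega>) l) \<partial>M) * e0" for k
  proof -
    define F where "F l \<omega> = grbk_factor A B \<alpha> (\<lambda>j. R j \<omega>) l" for l \<omega>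
    have F: "past_determined M I l (F l)" for l
      unfolding F_def grbk_factor_def
      by (rule past_determined_comp[OF me_grbk_past_determined(2)[OF process]])
    have step: "AE \<omega> in M. e (Suc l) \<omega> \<le> F l \<omega> * e l \<omega>" for l
      using contraction0[of l] contraction[of l] AE_space
      by eventually_elim (auto simp: F_def grbk_factor_def stopped_Suc)
    have "AE \<omega> in M. e (Suc k) \<omega> \<le> (\<Prod>l\<le>k. F l \<omega>) * e0" for k
    proof (induction k)
      case 0
      show ?case using step[of 0] AE_space by eventually_elim (simp add: e_0)
    next
      case (Suc k)
      from Suc step[of "Suc k"] AE_space show ?case
      proof eventually_elim
        case (elim \<omega>)
        show ?case
        \<comment> \<open>The inductive bound may only be multiplied by a nonnegative factor. A
          positive error forces this, since \<open>F (Suc k) \<omega> * e (Suc k) \<omega>\<close>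
          dominates the next error. A zero error means a zero residual, where the factor is
          \<open>0\<close> by convention.\<close>
        proof (cases "e (Suc k) \<omega> = 0")
          case True
          then have "R (Suc k) \<omega> = 0" using R[OF elim(3), of "Suc k"] by (simp add: e_def)
          then have "F (Suc k) \<omega> = 0" by (simp add: F_def grbk_factor_def)
          then show ?thesis using elim(2) by simp
        next
          case False
          then have pos: "e (Suc k) \<omega> > 0" using e_nonneg[of "Suc k" \<omega>] by simp
          have "0 \<le> F (Suc k) \<omega> * e (Suc k) \<omega>" using elim(2) e_nonneg[of "Suc (Suc k)" \<omega>] by linarith
          then have "F (Suc k) \<omega> \<ge> 0" using pos by (simp add: zero_le_mult_iff)
          then have "F (Suc k) \<omega> * e (Suc k) \<omega> \<le> F (Suc k) \<omega> * ((\<Prod>l\<le>k. F l \<omega>) * e0)"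
            by (intro mult_left_mono elim(1))
          with elim(2) show ?thesis by (simp add: mult_ac)
        qed
      qed
    qed
    then have "(\<integral>\<omega>. e (Suc k) \<omega> \<partial>M) \<le> (\<integral>\<omega>. (\<Prod>l\<le>k. F l \<omega>) * e0 \<partial>M)"
      by (intro integral_mono_AE e_int integrable[of k]
          past_determined_comp[of _ _ _ _ "\<lambda>x. x * e0"] past_determined_prod past_determined_mono[OF F]) auto
    then show ?thesis by (simp add: F_def)
  qed

  show ?thesis
    using least_norm_solution_iff[OF consistent] limit first conditional product
    unfolding e_def e0_def Xs[symmetric] by blast
qed

end
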